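(* For every integer $k\ge 1$ there exists a graph $G$ with $\operatorname{tw}(G)\le k$ and $\operatorname{box}(G)\ge k\left(1-\frac{2}{\sqrt{k}}\right)$.
   Context: The boxicity $\operatorname{box}(G)$ is the minimum $b$ such that $G$ is the intersection graph of axis-parallel boxes in $\mathbb{R}^b$ (products of $b$ closed intervals), one box per vertex. The treewidth $\operatorname{tw}(G)$ is the minimum, over all tree decompositions $(\{X_i\},T)$ of $G$ (a tree $T$ with vertex subsets $X_i$ at its nodes covering all vertices and all edges, such that for each vertex the nodes containing it form a connected subtree), of $\max_i|X_i|-1$. *)

theory Defs
  imports Complex_Main
begin

definition graph :: "nat set \<Rightarrow> (nat \<Rightarrow> nat \<Rightarrow> bool) \<Rightarrow> bool" where
  "graph V E \<longleftrightarrow> finite V \<and> (\<forall>u v. E u v \<longrightarrow> u \<in> V \<and> v \<in> V \<and> u \<noteq> v \<and> E v u)"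

text \<open>Box representation in dimension b: vertex v gets the box
  prod_{i<b} [l v i, r v i]; distinct vertices are adjacent iff their boxes intersect.\<close>
definition box_rep :: "nat set \<Rightarrow> (nat \<Rightarrow> nat \<Rightarrow> bool) \<Rightarrow> nat \<Rightarrow> bool" where
  "box_rep V E b \<longleftrightarrow> (\<exists>l r :: nat \<Rightarrow> nat \<Rightarrow> real.
     (\<forall>v\<in>V. \<forall>i<b. l v i \<le> r v i) \<and>
     (\<forall>u\<in>V. \<forall>v\<in>V. u \<noteq> v \<longrightarrow>
        (E u v \<longleftrightarrow> (\<forall>i<b. l u i \<le> r v i \<and> l v i \<le> r u i))))"

definition boxicity :: "nat set \<Rightarrow> (nat \<Rightarrow> nat \<Rightarrow> bool) \<Rightarrow> nat" where
  "boxicity V E = (LEAST b. box_rep V E b)"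

definition connected_in :: "(nat \<Rightarrow> nat \<Rightarrow> bool) \<Rightarrow> nat set \<Rightarrow> bool" where
  "connected_in TE S \<longleftrightarrow>
     (\<forall>s\<in>S. \<forall>t\<in>S. (\<lambda>a b. TE a b \<and> a \<in> S \<and> b \<in> S)\<^sup>*\<^sup>* s t)"

definition is_tree :: "nat set \<Rightarrow> (nat \<Rightarrow> nat \<Rightarrow> bool) \<Rightarrow> bool" where
  "is_tree N TE \<longleftrightarrow> graph N TE \<and> N \<noteq> {} \<and> connected_in TE N \<and>
     card {{a, b} | a b. TE a b} = card N - 1"

definition tree_decomp ::
  "nat set \<Rightarrow> (nat \<Rightarrow> nat \<Rightarrow> bool) \<Rightarrow> nat set \<Rightarrow> (nat \<Rightarrow> nat \<Rightarrow> bool) \<Rightarrow> (nat \<Rightarrow> nat set) \<Rightarrow> bool"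
  where
  "tree_decomp V E N TE X \<longleftrightarrow> is_tree N TE \<and>
     (\<forall>t\<in>N. X t \<subseteq> V) \<and>
     (\<forall>v\<in>V. \<exists>t\<in>N. v \<in> X t) \<and>
     (\<forall>u v. E u v \<longrightarrow> (\<exists>t\<in>N. u \<in> X t \<and> v \<in> X t)) \<and>
     (\<forall>v\<in>V. connected_in TE {t\<in>N. v \<in> X t})"

definition treewidth :: "nat set \<Rightarrow> (nat \<Rightarrow> nat \<Rightarrow> bool) \<Rightarrow> nat" where
  "treewidth V E = (LEAST w. \<exists>N TE X. tree_decomp V E N TE X \<and> (\<forall>t\<in>N. card (X t) \<le> w + 1))"

end

theory Submission
  imports Defs "HOL-Library.Nat_Bijection"
begin

text \<open>
  The graph is a universal graph of treewidth at most \<open>k\<close>: below every node of the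
  decomposition tree up to depth \<open>2 k\<close>, every way of discarding bag members and adding one vertex
  with prescribed neighbours in the bag occurs. Its boxicity is at least \<open>k - 1\<close>, which exceeds
  \<open>k - 2 \<surd>k\<close>.

  In a given box representation, walk down the tree while blocking more and more dimensions: a
  dimension \<open>e\<close> is blocked when some point \<open>p e\<close> lies in the side of every box adjacent to the
  current bag, so that \<open>e\<close> cannot separate later vertices. Start from an active vertex \<open>v\<close> and add
  pairwise adjacent clones, nonadjacent to \<open>v\<close> but adjacent to the rest of the bag, until they
  outnumber the set \<open>D\<close> of dimensions in which they are separated from \<open>v\<close>. Then
  some clone \<open>a\<close> is not the chosen farthest clone from \<open>v\<close> in any dimension of \<open>D\<close>. Anything meeting \<open>v\<close> and the
  farthest clones crosses over to \<open>a\<close>, so all of \<open>D\<close> becomes blocked and \<open>a\<close> is the next active vertex.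
  The farthest clones in the dimensions separating \<open>v\<close> from \<open>a\<close> can be discarded one step
  later, since \<open>v\<close> and \<open>a\<close> together block these dimensions. Thus each blocked dimension costs only
  one bag vertex.
\<close>

section \<open>Intervals separated from a given interval\<close>

text \<open>Since the intervals of \<open>W\<close> meet pairwise, the separated ones all lie to the
  right of \<open>v\<close>; \<open>f\<close> is one with the largest left endpoint. Any [x, y]
  meeting both \<open>v\<close> and \<open>f\<close> contains everything from \<open>r v\<close> to
  \<open>l f\<close>. So p = \<open>l a\<close> works for a separated \<open>a\<close>, and p =
  \<open>l f\<close> for any other, which itself reaches from \<open>v\<close> to
  \<open>f\<close>.\<close>

lemma farthest_right:
  fixes l r :: "'a \<Rightarrow> real"
  assumes "finite W" and "\<And>w. w \<in> W \<Longrightarrow> l w \<le> r w" and "l v \<le> r v"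
    and meet: "\<And>w w'. w \<in> W \<Longrightarrow> w' \<in> W \<Longrightarrow> l w \<le> r w'"
    and S: "S = {w \<in> W. r v < l w \<or> r w < l v}"
    and w0: "w0 \<in> W" "r v < l w0"
  shows "\<exists>f\<in>S. \<forall>a\<in>W. \<exists>p. l a \<le> p \<and> p \<le> r a \<and>
     (\<forall>x y. x \<le> r v \<and> l v \<le> y \<and> x \<le> r f \<and> l f \<le> y \<longrightarrow> x \<le> p \<and> p \<le> y) \<and>
     (a \<in> S \<longrightarrow> (\<forall>x y. x \<le> r v \<and> l v \<le> y \<and> x \<le> r a \<and> l a \<le> y \<longrightarrow> x \<le> p \<and> p \<le> y))"
proof -
  have right: "r v < l w" if "w \<in> S" for w
    using that S w0 meet[of w0 w] assms(3) by force
  have "finite S" "S \<noteq> {}" using assms(1) S w0 by auto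
  then have "Max (l ` S) \<in> l ` S" by simp
  then obtain f where f: "f \<in> S" "l f = Max (l ` S)" by auto
  have far: "l w \<le> l f" if "w \<in> S" for w
    using that f \<open>finite S\<close> by simp
  have "\<exists>p. l a \<le> p \<and> p \<le> r a \<and>
     (\<forall>x y. x \<le> r v \<and> l v \<le> y \<and> x \<le> r f \<and> l f \<le> y \<longrightarrow> x \<le> p \<and> p \<le> y) \<and>
     (a \<in> S \<longrightarrow> (\<forall>x y. x \<le> r v \<and> l v \<le> y \<and> x \<le> r a \<and> l a \<le> y \<longrightarrow> x \<le> p \<and> p \<le> y))"
    if a: "a \<in> W" for a
  proof (cases "a \<in> S")
    case True
    show ?thesis
      using right[OF True] far[OF True] assms(2)[OF a] by (intro exI[of _ "l a"]) auto
  next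
    case False
    then have "l a \<le> r v" using a S by auto
    moreover have "f \<in> W" using f S by auto
    ultimately show ?thesis
      using False right[OF f(1)] meet[of f a] a by (intro exI[of _ "l f"]) auto
  qed
  then show ?thesis using f(1) by blast
qed

lemma farthest:
  fixes l r :: "'a \<Rightarrow> real"
  assumes "finite W" and "\<And>w. w \<in> W \<Longrightarrow> l w \<le> r w" and "l v \<le> r v"
    and meet: "\<And>w w'. w \<in> W \<Longrightarrow> w' \<in> W \<Longrightarrow> l w \<le> r w'"
    and S: "S = {w \<in> W. r v < l w \<or> r w < l v}" "S \<noteq> {}"
  shows "\<exists>f\<in>S. \<forall>a\<in>W. \<exists>p. l a \<le> p \<and> p \<le> r a \<and>
     (\<forall>x y. x \<le> r v \<and> l v \<le> y \<and> x \<le> r f \<and> l f \<le> y \<longrightarrow> x \<le> p \<and> p \<le> y) \<and>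
     (a \<in> S \<longrightarrow> (\<forall>x y. x \<le> r v \<and> l v \<le> y \<and> x \<le> r a \<and> l a \<le> y \<longrightarrow> x \<le> p \<and> p \<le> y))"
proof (cases "\<exists>w\<in>W. r v < l w")
  case True
  then show ?thesis using farthest_right[OF assms(1-5)] by blast
next
  case False
  then obtain w0 where w0: "w0 \<in> W" "r w0 < l v" using S by auto
  \<comment> \<open>Here the separated intervals lie to the left of \<open>v\<close>; negating all
    coordinates swaps the sides.\<close>
  have "\<exists>f\<in>S. \<forall>a\<in>W. \<exists>p. - r a \<le> p \<and> p \<le> - l a \<and>
     (\<forall>x y. x \<le> - l v \<and> - r v \<le> y \<and> x \<le> - l f \<and> - r f \<le> y \<longrightarrow> x \<le> p \<and> p \<le> y) \<and>
     (a \<in> S \<longrightarrow> (\<forall>x y. x \<le> - l v \<and> - r v \<le> y \<and> x \<le> - l a \<and> - r a \<le> y \<longrightarrow> x \<le> p \<and> p \<le> y))"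
    by (rule farthest_right[where l = "\<lambda>w. - r w" and r = "\<lambda>w. - l w"])
      (use assms w0 in auto)
  then obtain f where "f \<in> S" and f: "\<And>a. a \<in> W \<Longrightarrow> \<exists>p. - r a \<le> p \<and> p \<le> - l a \<and>
     (\<forall>x y. x \<le> - l v \<and> - r v \<le> y \<and> x \<le> - l f \<and> - r f \<le> y \<longrightarrow> x \<le> p \<and> p \<le> y) \<and>
     (a \<in> S \<longrightarrow> (\<forall>x y. x \<le> - l v \<and> - r v \<le> y \<and> x \<le> - l a \<and> - r a \<le> y \<longrightarrow> x \<le> p \<and> p \<le> y))"
    by blast
  have "\<exists>p. l a \<le> p \<and> p \<le> r a \<and>
     (\<forall>x y. x \<le> r v \<and> l v \<le> y \<and> x \<le> r f \<and> l f \<le> y \<longrightarrow> x \<le> p \<and> p \<le> y) \<and>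
     (a \<in> S \<longrightarrow> (\<forall>x y. x \<le> r v \<and> l v \<le> y \<and> x \<le> r a \<and> l a \<le> y \<longrightarrow> x \<le> p \<and> p \<le> y))"
    if a: "a \<in> W" for a
  proof -
    obtain p where p: "- r a \<le> p" "p \<le> - l a"
      "\<And>x y. x \<le> - l v \<and> - r v \<le> y \<and> x \<le> - l f \<and> - r f \<le> y \<Longrightarrow> x \<le> p \<and> p \<le> y"
      "\<And>x y. a \<in> S \<Longrightarrow> x \<le> - l v \<and> - r v \<le> y \<and> x \<le> - l a \<and> - r a \<le> y \<Longrightarrow> x \<le> p \<and> p \<le> y"
      using f[OF a] by blast
    have "x \<le> - p \<and> - p \<le> y" if "x \<le> r v \<and> l v \<le> y \<and> x \<le> r f \<and> l f \<le> y" for x y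
      using p(3)[of "- y" "- x"] that by auto
    moreover have "x \<le> - p \<and> - p \<le> y"
      if "a \<in> S" "x \<le> r v \<and> l v \<le> y \<and> x \<le> r a \<and> l a \<le> y" for x y
      using p(4)[of "- y" "- x"] that by auto
    ultimately show ?thesis using p(1,2) by (intro exI[of _ "- p"]) auto
  qed
  then show ?thesis using \<open>f \<in> S\<close> by blast
qed

section \<open>Frames and clones in a box representation\<close>

locale box_representation =
  fixes V :: "nat set" and E :: "nat \<Rightarrow> nat \<Rightarrow> bool" and b :: nat
    and l r :: "nat \<Rightarrow> nat \<Rightarrow> real"
  assumes graph: "graph V E"
    and box: "v \<in> V \<Longrightarrow> i < b \<Longrightarrow> l v i \<le> r v i"
    and adj: "u \<in> V \<Longrightarrow> v \<in> V \<Longrightarrow> u \<noteq> v \<Longrightarrow>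
      E u v \<longleftrightarrow> (\<forall>i<b. l u i \<le> r v i \<and> l v i \<le> r u i)"
begin

lemma edgeD: "E u v \<Longrightarrow> u \<in> V \<and> v \<in> V \<and> u \<noteq> v \<and> E v u"
  using graph unfolding graph_def by blast

lemma edge_meets: "E u v \<Longrightarrow> i < b \<Longrightarrow> l u i \<le> r v i \<and> l v i \<le> r u i"
  using adj edgeD by blast

definition covers :: "(nat \<Rightarrow> real) \<Rightarrow> nat set \<Rightarrow> nat \<Rightarrow> bool" where
  "covers p B q \<longleftrightarrow> (\<forall>e\<in>B. l q e \<le> p e \<and> p e \<le> r q e)"

text \<open>\<open>v\<close> is the active vertex, \<open>B\<close> the set of blocked dimensions. The vertices of \<open>H\<close> stand in for \<open>v\<close> in
  blocking \<open>B\<close> as long as new vertices avoid \<open>v\<close>, and can be dropped afterwards.\<close>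

definition frame :: "nat set \<Rightarrow> nat set \<Rightarrow> nat \<Rightarrow> nat set \<Rightarrow> (nat \<Rightarrow> real) \<Rightarrow> bool" where
  "frame C H v B p \<longleftrightarrow> v \<in> V - (C \<union> H) \<and> finite C \<and> finite H \<and> B \<subseteq> {..<b} \<and>
     card C \<le> card B \<and> card (C \<union> H) \<le> card B + 1 \<and> covers p B v \<and>
     (\<forall>q. (\<forall>u\<in>insert v C. E q u) \<longrightarrow> covers p B q) \<and>
     (\<forall>q\<in>V. (\<forall>u\<in>C \<union> H. E q u) \<longrightarrow> covers p B q)"

definition clones :: "nat set \<Rightarrow> nat set \<Rightarrow> nat \<Rightarrow> nat set \<Rightarrow> bool" where
  "clones C H v W \<longleftrightarrow> finite W \<and> W \<subseteq> V - {v} \<and>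
     (\<forall>w\<in>W. \<not> E v w \<and> (\<forall>u\<in>C \<union> H. E w u) \<and> (\<forall>w'\<in>W. w \<noteq> w' \<longrightarrow> E w w'))"

definition separated :: "nat \<Rightarrow> nat set \<Rightarrow> nat \<Rightarrow> nat set" where
  "separated v W i = {w \<in> W. r v i < l w i \<or> r w i < l v i}"

definition sep_dims :: "nat \<Rightarrow> nat set \<Rightarrow> nat set" where
  "sep_dims v W = {i. i < b \<and> separated v W i \<noteq> {}}"

lemma finite_sep_dims [simp]: "finite (sep_dims v W)"
  unfolding sep_dims_def by simp

text \<open>In a blocked dimension \<open>e\<close> the point \<open>p e\<close> lies in the side of
  \<open>v\<close> and, by adjacency to all of \<open>C \<union> H\<close>, in that of every
  clone.\<close>

lemma sep_dims_disjoint: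
  assumes "frame C H v B p" "clones C H v W"
  shows "B \<inter> sep_dims v W = {}"
proof -
  have "e \<notin> sep_dims v W" if e: "e \<in> B" for e
  proof
    assume "e \<in> sep_dims v W"
    then obtain w where w: "w \<in> W" "r v e < l w e \<or> r w e < l v e"
      unfolding sep_dims_def separated_def by auto
    have "w \<in> V" "\<forall>u\<in>C \<union> H. E w u" using assms(2) w(1) unfolding clones_def by auto
    then have "covers p B w" using assms(1) unfolding frame_def by blast
    moreover have "covers p B v" using assms(1) unfolding frame_def by blast
    ultimately show False using w(2) e unfolding covers_def by fastforce
  qed
  then show ?thesis by blast
qed

lemma card_dims_le:
  assumes "frame C H v B p" "clones C H v W"
  shows "card B + card (sep_dims v W) \<le> b"
proof -
  have B: "B \<subseteq> {..<b}" using assms(1) unfolding frame_def by blast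
  then have "card B + card (sep_dims v W) = card (B \<union> sep_dims v W)"
    using sep_dims_disjoint[OF assms] by (simp add: card_Un_disjoint finite_subset[OF B])
  also have "\<dots> \<le> card {..<b}"
    using B by (intro card_mono) (auto simp: sep_dims_def)
  finally show ?thesis by simp
qed

lemma sep_dims_clone:
  assumes "clones C H v W" "v \<in> V" "a \<in> W"
  obtains i where "i \<in> sep_dims v W" "a \<in> separated v W i"
proof -
  have "a \<in> V" "a \<noteq> v" "\<not> E v a" using assms unfolding clones_def by auto
  then obtain i where "i < b" "r v i < l a i \<or> r a i < l v i"
    using adj[of v a] assms(2) by (auto simp: not_le)
  then show ?thesis using that assms(3) unfolding sep_dims_def separated_def by blast
qed

lemma frame_advance:
  assumes fr: "frame C H v B p" and cl: "clones C H v W"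
    and many: "card (sep_dims v W) < card W"
  obtains C' H' a p' where "frame C' H' a (B \<union> sep_dims v W) p'"
    "a \<in> W" "C' \<union> H' \<subseteq> insert v (C \<union> W)"
proof -
  let ?D = "sep_dims v W" and ?S = "separated v W"
  have v: "v \<in> V" and B: "B \<subseteq> {..<b}" and fin: "finite C" "finite H" "finite W"
    and W: "W \<subseteq> V"
    using fr cl unfolding frame_def clones_def by auto
  define good where "good d f a t \<longleftrightarrow> l a d \<le> t \<and> t \<le> r a d \<and>
     (\<forall>x y. x \<le> r v d \<and> l v d \<le> y \<and> x \<le> r f d \<and> l f d \<le> y \<longrightarrow> x \<le> t \<and> t \<le> y) \<and>
     (a \<in> ?S d \<longrightarrow> (\<forall>x y. x \<le> r v d \<and> l v d \<le> y \<and> x \<le> r a d \<and> l a d \<le> y \<longrightarrow> x \<le> t \<and> t \<le> y))"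
    for d f a t
  have "\<exists>f\<in>?S d. \<forall>a\<in>W. \<exists>t. good d f a t" if d: "d \<in> ?D" for d
    unfolding good_def
  proof (rule farthest)
    have "d < b" using d unfolding sep_dims_def by auto
    then show "l v d \<le> r v d" "\<And>w. w \<in> W \<Longrightarrow> l w d \<le> r w d" using box v W by auto
    then show "l w d \<le> r w' d" if "w \<in> W" "w' \<in> W" for w w'
      using that cl edge_meets[OF _ \<open>d < b\<close>, of w w'] unfolding clones_def by (cases "w = w'") auto
    show "?S d \<noteq> {}" using d unfolding sep_dims_def by auto
  qed (use fin in \<open>auto simp: separated_def\<close>)
  then obtain f where f: "\<And>d. d \<in> ?D \<Longrightarrow> f d \<in> ?S d"
    and good: "\<And>d a. d \<in> ?D \<Longrightarrow> a \<in> W \<Longrightarrow> \<exists>t. good d (f d) a t"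
    by metis
  have fW: "f ` ?D \<subseteq> W" using f unfolding separated_def by auto
  have "card (f ` ?D) < card W" using many card_image_le[of ?D f] by simp
  then obtain a where a: "a \<in> W" "a \<notin> f ` ?D"
    using fW by (metis less_irrefl subsetI subset_antisym)
  define t where "t d = (SOME x. good d (f d) a x)" for d
  have t: "good d (f d) a (t d)" if "d \<in> ?D" for d
    unfolding t_def using good[OF that a(1)] by (rule someI_ex)
  define p' where "p' d = (if d \<in> B then p d else t d)" for d
  \<comment> \<open>\<open>?A\<close> collects the dimensions separating \<open>v\<close> from
    \<open>a\<close>. There \<open>v\<close> and \<open>a\<close> already force every common
    neighbour over \<open>t d\<close>, so the farthest clones of \<open>?A\<close> are needed only
    while \<open>a\<close> is avoided and go to \<open>H'\<close>. In the other dimensions of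
    \<open>?D\<close> they stay in \<open>C'\<close>.\<close>
  let ?A = "{d \<in> ?D. a \<in> ?S d}"
  define H' where "H' = f ` ?A"
  define C' where "C' = insert v C \<union> f ` (?D - ?A)"
  have disj: "B \<inter> ?D = {}" using sep_dims_disjoint[OF fr cl] .
  have cov: "covers p' (B \<union> ?D) q"
    if "covers p B q" "\<And>d. d \<in> ?D \<Longrightarrow> l q d \<le> t d \<and> t d \<le> r q d" for q
    using that disj unfolding covers_def p'_def by auto
  have meets_f: "l q d \<le> t d \<and> t d \<le> r q d" if "d \<in> ?D" "E q v" "E q (f d)" for q d
  proof -
    have "d < b" using that(1) unfolding sep_dims_def by auto
    then show ?thesis
      using t[OF that(1)] edge_meets[OF that(2)] edge_meets[OF that(3)] unfolding good_def by blast
  qed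
  have meets_a: "l q d \<le> t d \<and> t d \<le> r q d" if "d \<in> ?A" "E q v" "E q a" for q d
  proof -
    have d: "d \<in> ?D" "a \<in> ?S d" using that(1) by auto
    then have "d < b" unfolding sep_dims_def by auto
    then show ?thesis
      using t[OF d(1)] d(2) edge_meets[OF that(2)] edge_meets[OF that(3)] unfolding good_def by blast
  qed
  have finA: "?A \<subseteq> ?D" "finite ?A" by (auto simp: sep_dims_def)
  have cardB: "card (B \<union> ?D) = card B + card ?D"
    using disj finite_subset[OF B] by (simp add: card_Un_disjoint)
  \<comment> \<open>As \<open>v\<close> and \<open>a\<close> are not adjacent, at least one
    dimension needs no permanent clone. This saving pays for moving \<open>v\<close> into
    \<open>C'\<close>.\<close>
  have "?A \<noteq> {}" using sep_dims_clone[OF cl v a(1)] by blast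
  then have "0 < card ?A" using finA by (simp add: card_gt_0_iff)
  then have cardA: "card (?D - ?A) + 1 \<le> card ?D"
    using finA card_mono[OF finite_sep_dims finA(1)] by (simp add: card_Diff_subset)
  have cC: "card C \<le> card B" using fr unfolding frame_def by blast
  have "card C' \<le> card (insert v C) + card (f ` (?D - ?A))"
    unfolding C'_def by (rule card_Un_le)
  also have "\<dots> \<le> (card C + 1) + card (?D - ?A)"
    using fin card_image_le[of "?D - ?A" f]
    by (intro add_mono) (auto simp: card_insert_if)
  finally have cC': "card C' \<le> card (B \<union> ?D)" using cardA cC cardB by linarith
  have CH': "C' \<union> H' = insert v C \<union> f ` ?D" unfolding C'_def H'_def by auto
  have "card (C' \<union> H') \<le> card (insert v C) + card (f ` ?D)"
    unfolding CH' by (simp add: card_Un_le del: Un_insert_left)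
  also have "\<dots> \<le> (card C + 1) + card ?D"
    using fin card_image_le[of ?D f] by (intro add_mono) (auto simp: card_insert_if)
  finally have cCH': "card (C' \<union> H') \<le> card (B \<union> ?D) + 1" using cC cardB by linarith
  have "covers p B a"
    using fr cl a(1) W unfolding frame_def clones_def by blast
  then have cov_a: "covers p' (B \<union> ?D) a"
    using t by (intro cov) (auto simp: good_def)
  have old: "covers p B q" if "\<forall>u\<in>insert v C. E q u" for q
    using fr that unfolding frame_def by blast
  have "covers p' (B \<union> ?D) q" if q: "\<forall>u\<in>insert a C'. E q u" for q
  proof (rule cov)
    show "covers p B q" using old q unfolding C'_def by auto
    show "l q d \<le> t d \<and> t d \<le> r q d" if "d \<in> ?D" for d
      using meets_a meets_f that q unfolding C'_def by (cases "d \<in> ?A") auto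
  qed
  moreover have "covers p' (B \<union> ?D) q" if q: "\<forall>u\<in>C' \<union> H'. E q u" for q
  proof (rule cov)
    show "covers p B q" using old q unfolding C'_def by auto
    show "l q d \<le> t d \<and> t d \<le> r q d" if "d \<in> ?D" for d
      using meets_f[OF that] that q unfolding CH' by auto
  qed
  moreover have "finite C'" "finite H'" using fin finA unfolding C'_def H'_def by auto
  moreover have "B \<union> ?D \<subseteq> {..<b}" using B unfolding sep_dims_def by auto
  moreover have "a \<in> V - (C' \<union> H')"
    using a W cl edgeD unfolding C'_def H'_def clones_def by blast
  ultimately have "frame C' H' a (B \<union> ?D) p'"
    using cC' cCH' cov_a unfolding frame_def by blast
  then show ?thesis
    using that a(1) fW unfolding C'_def H'_def by blast
qed

text \<open>\<open>T n\<close> stands for the set of bags reachable after \<open>n\<close> additions. Every addition increases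
  \<open>2 * card B + card W\<close>, which is at most \<open>2 * b\<close>; hence depth \<open>2 * k\<close> suffices.\<close>

lemma dimension_lower_bound:
  assumes start: "v0 \<in> V" "T 0 {v0}"
    and extend: "\<And>n X Y N. T n X \<Longrightarrow> n < 2 * k \<Longrightarrow> N \<subseteq> Y \<Longrightarrow> Y \<subseteq> X \<Longrightarrow> card Y \<le> k \<Longrightarrow>
      \<exists>w\<in>V - X. T (Suc n) (insert w Y) \<and> (\<forall>u\<in>Y. E w u \<longleftrightarrow> u \<in> N)"
  shows "k \<le> b + 1"
proof (rule ccontr)
  assume "\<not> k \<le> b + 1"
  then have k: "b + 2 \<le> k" by simp
  define state where "state n X C H v B p W \<longleftrightarrow> T n X \<and> frame C H v B p \<and> clones C H v W \<and>
      card W \<le> card (sep_dims v W) \<and> C \<union> H \<union> W \<union> {v} \<subseteq> X \<and> n \<le> 2 * card B + card W"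
    for n X C H v B p W
  have "\<exists>X C H v B p W. state n X C H v B p W" if "n \<le> 2 * b + 1" for n
    using that
  proof (induction n)
    case 0
    have "state 0 {v0} {} {} v0 {} (\<lambda>_. 0) {}"
      unfolding state_def frame_def clones_def covers_def using start by auto
    then show ?case by blast
  next
    case (Suc n)
    from Suc.prems have "n \<le> 2 * b + 1" by simp
    from Suc.IH[OF this] obtain X C H v B p W where "state n X C H v B p W" by blast
    then have T: "T n X" and fr: "frame C H v B p"
      and cl: "clones C H v W" and few: "card W \<le> card (sep_dims v W)"
      and sub: "C \<union> H \<union> W \<union> {v} \<subseteq> X" and n: "n \<le> 2 * card B + card W"
      unfolding state_def by simp_all
    \<comment> \<open>The next clone must avoid \<open>v\<close>, but \<open>v\<close> has to stay
      in the bag for a later change of active vertex.\<close>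
    let ?N = "C \<union> H \<union> W"
    let ?Y = "insert v ?N"
    have fin: "finite C" "finite H" "finite W" and cCH: "card (C \<union> H) \<le> card B + 1"
      and v: "v \<in> V" "v \<notin> C \<union> H" and vW: "v \<notin> W" and W: "W \<subseteq> V"
      using fr cl unfolding frame_def clones_def by auto
    have "card ?Y \<le> card (C \<union> H) + card W + 1"
      using fin card_Un_le[of "C \<union> H" W] by (simp add: card_insert_if)
    \<comment> \<open>The bound is (\<open>card B\<close> + 1) + \<open>card (sep_dims v W)\<close>
      + 1 \<le> \<open>b\<close> + 2, which is where the assumed \<open>b + 2 \<le> k\<close> comes
      from.\<close>
    then have "card ?Y \<le> k" using cCH few card_dims_le[OF fr cl] k by linarith
    moreover have "n < 2 * k" using Suc.prems k by linarith
    moreover have "?N \<subseteq> ?Y" "?Y \<subseteq> X" using sub by auto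
    ultimately obtain w where w: "w \<in> V - X" "T (Suc n) (insert w ?Y)"
      "\<And>u. u \<in> ?Y \<Longrightarrow> E w u \<longleftrightarrow> u \<in> ?N"
      using extend[OF T] by meson
    have "w \<noteq> v" "w \<notin> W" using w(1) sub by auto
    have "\<not> E w v" using w(3)[of v] v vW by auto
    moreover have "E w u" if "u \<in> ?N" for u using w(3) that by blast
    ultimately have cl': "clones C H v (insert w W)"
      using cl w(1) \<open>w \<noteq> v\<close> edgeD unfolding clones_def by blast
    have cW: "card (insert w W) = card W + 1" using fin \<open>w \<notin> W\<close> by simp
    show ?case
    proof (cases "card (insert w W) \<le> card (sep_dims v (insert w W))")
      case True
      have "C \<union> H \<union> insert w W \<union> {v} \<subseteq> insert w ?Y" by auto
      moreover have "Suc n \<le> 2 * card B + card (insert w W)" using n cW by simp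
      ultimately have "state (Suc n) (insert w ?Y) C H v B p (insert w W)"
        using w(2) fr cl' True unfolding state_def by blast
      then show ?thesis by blast
    next
      case False
      let ?D = "sep_dims v (insert w W)"
      from False have "card ?D < card (insert w W)" by simp
      from frame_advance[OF fr cl' this] obtain C' H' a p'
        where fr': "frame C' H' a (B \<union> ?D) p'" and a: "a \<in> insert w W"
          and sub': "C' \<union> H' \<subseteq> insert v (C \<union> insert w W)" .
      \<comment> \<open>The clones are reset to none, yet the potential grows:
        \<open>card W \<le> card ?D\<close> and \<open>?D\<close> nonempty give 2 *
        \<open>card ?D\<close> \<ge> \<open>card W\<close> + 1.\<close>
      have "sep_dims v W \<subseteq> ?D" unfolding sep_dims_def separated_def by auto
      then have "card (sep_dims v W) \<le> card ?D" by (simp add: card_mono)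
      moreover have "?D \<noteq> {}" using sep_dims_clone[OF cl' v(1), of w] by blast
      then have "0 < card ?D" by (simp add: card_gt_0_iff)
      moreover have "card (B \<union> ?D) = card B + card ?D"
        using sep_dims_disjoint[OF fr cl'] fr finite_subset[of B "{..<b}"]
        unfolding frame_def by (simp add: card_Un_disjoint)
      ultimately have "Suc n \<le> 2 * card (B \<union> ?D) + card {}"
        using n few False cW by simp
      moreover have "clones C' H' a {}" unfolding clones_def by simp
      moreover have "C' \<union> H' \<union> {} \<union> {a} \<subseteq> insert w ?Y" using sub' a by auto
      ultimately have "state (Suc n) (insert w ?Y) C' H' a (B \<union> ?D) p' {}"
        using w(2) fr' unfolding state_def by simp
      then show ?thesis by blast
    qed
  qed
  then obtain X C H v B p W where "state (2 * b + 1) X C H v B p W" by blast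
  then have fr: "frame C H v B p" and cl: "clones C H v W"
    and "card W \<le> card (sep_dims v W)" "2 * b + 1 \<le> 2 * card B + card W"
    unfolding state_def by simp_all
  then show False using card_dims_le[OF fr cl] by linarith
qed

end

section \<open>Tree decompositions from parent functions\<close>

lemma parent_connected:
  fixes par :: "nat \<Rightarrow> nat"
  assumes TE: "\<And>a. a \<in> S \<Longrightarrow> a \<noteq> c \<Longrightarrow> par a \<in> S \<and> par a < a \<and> TE a (par a) \<and> TE (par a) a"
  shows "connected_in TE S"
proof -
  define R where "R = (\<lambda>a b. TE a b \<and> a \<in> S \<and> b \<in> S)"
  have "R\<^sup>*\<^sup>* s c \<and> R\<^sup>*\<^sup>* c s" if "s \<in> S" for s
    using that
  proof (induction s rule: less_induct)
    case (less s)
    show ?case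
    proof (cases "s = c")
      case False
      then have "R s (par s)" "R (par s) s" "R\<^sup>*\<^sup>* (par s) c" "R\<^sup>*\<^sup>* c (par s)"
        using TE[OF less.prems False] less by (auto simp: R_def)
      then show ?thesis
        by (meson converse_rtranclp_into_rtranclp rtranclp.rtrancl_into_rtrancl)
    qed simp
  qed
  then show ?thesis unfolding connected_in_def R_def[symmetric] by (meson rtranclp_trans)
qed

text \<open>By \<open>step\<close>, a vertex \<open>v\<close> can enter a bag only at node
  \<open>v\<close>. Climbing through parents from any bag containing \<open>v\<close> therefore
  keeps \<open>v\<close> until node \<open>v\<close> is reached, so these nodes are
  connected.\<close>

lemma parent_tree_decomp:
  fixes par :: "nat \<Rightarrow> nat"
  assumes fin: "finite V" and root: "0 \<in> V" "X 0 = {0}"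
    and par: "\<And>t. t \<in> V \<Longrightarrow> t \<noteq> 0 \<Longrightarrow> par t \<in> V \<and> par t < t"
    and X: "\<And>t. t \<in> V \<Longrightarrow> t \<in> X t \<and> X t \<subseteq> V"
    and step: "\<And>t. t \<in> V \<Longrightarrow> t \<noteq> 0 \<Longrightarrow> X t \<subseteq> insert t (X (par t))"
    and edge: "\<And>u w. E u w \<Longrightarrow> u \<in> V \<and> w \<in> V \<and> (u \<in> X w \<or> w \<in> X u)"
  shows "\<exists>TE. tree_decomp V E V TE X"
proof -
  define TE where "TE a b \<longleftrightarrow> a \<in> V \<and> b \<in> V \<and> ((a \<noteq> 0 \<and> b = par a) \<or> (b \<noteq> 0 \<and> a = par b))"
    for a b
  have conn: "connected_in TE S"
    if "S \<subseteq> V" "\<And>s. s \<in> S \<Longrightarrow> s \<noteq> c \<Longrightarrow> s \<noteq> 0 \<and> par s \<in> S" for S c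
    using that par by (intro parent_connected[of S c par]) (auto simp: TE_def)
  have "{{a, b} | a b. TE a b} = (\<lambda>t. {t, par t}) ` (V - {0})"
    using par unfolding TE_def by (auto simp: insert_commute)
  \<comment> \<open>The child is the larger end of its edge.\<close>
  moreover have "inj_on (\<lambda>t. {t, par t}) (V - {0})"
  proof (rule inj_onI)
    fix s t assume "s \<in> V - {0}" "t \<in> V - {0}" "{s, par s} = {t, par t}"
    then show "s = t" using par[of s] par[of t] by (auto simp: doubleton_eq_iff)
  qed
  ultimately have "card {{a, b} | a b. TE a b} = card V - 1"
    using root(1) fin by (simp add: card_image)
  moreover have "graph V TE" using fin par unfolding graph_def TE_def by fastforce
  moreover have "connected_in TE V" using par by (intro conn[of V 0]) auto
  ultimately have "is_tree V TE" using root(1) unfolding is_tree_def by auto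
  moreover have "connected_in TE {t \<in> V. v \<in> X t}" if "v \<in> V" for v
  proof (rule conn[of "{t \<in> V. v \<in> X t}" v])
    fix s assume s: "s \<in> {t \<in> V. v \<in> X t}" "s \<noteq> v"
    then have "s \<noteq> 0" using root(2) by (metis (mono_tags) mem_Collect_eq singletonD)
    then show "s \<noteq> 0 \<and> par s \<in> {t \<in> V. v \<in> X t}" using par step s by blast
  qed auto
  ultimately have "tree_decomp V E V TE X"
    using X edge unfolding tree_decomp_def by blast
  then show ?thesis by blast
qed

section \<open>A universal graph of bounded treewidth\<close>

text \<open>A vertex other than the root \<open>0\<close> encodes the parent \<open>p\<close> of its tree node, the part \<open>Y\<close> of the bag of \<open>p\<close>
  that is kept, and its set \<open>N\<close> of neighbours within \<open>Y\<close>. Vertices double as tree nodes.\<close>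

definition node_code :: "nat \<Rightarrow> nat set \<Rightarrow> nat set \<Rightarrow> nat" where
  "node_code p Y N = Suc (prod_encode (p, prod_encode (set_encode Y, set_encode N)))"

definition parent :: "nat \<Rightarrow> nat" where
  "parent w = fst (prod_decode (w - 1))"

definition kept :: "nat \<Rightarrow> nat set" where
  "kept w = set_decode (fst (prod_decode (snd (prod_decode (w - 1)))))"

definition nbrs :: "nat \<Rightarrow> nat set" where
  "nbrs w = set_decode (snd (prod_decode (snd (prod_decode (w - 1)))))"

definition bag :: "nat \<Rightarrow> nat set" where
  "bag w = (if w = 0 then {0} else insert w (kept w))"

text \<open>Level \<open>n\<close> holds all nodes of depth at most \<open>n\<close>; reinserting
  the root makes the levels increase.\<close>

primrec nodes :: "nat \<Rightarrow> nat \<Rightarrow> nat set" where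
  "nodes k 0 = {0}"
| "nodes k (Suc n) = insert 0 {node_code p Y N | p Y N.
     p \<in> nodes k n \<and> N \<subseteq> Y \<and> Y \<subseteq> bag p \<and> card Y \<le> k}"

definition adjacent :: "nat set \<Rightarrow> nat \<Rightarrow> nat \<Rightarrow> bool" where
  "adjacent V u w \<longleftrightarrow> u \<in> V \<and> w \<in> V \<and> (w \<noteq> 0 \<and> u \<in> nbrs w \<or> u \<noteq> 0 \<and> w \<in> nbrs u)"

lemma node_code_simps [simp]:
  "node_code p Y N \<noteq> 0" "parent (node_code p Y N) = p"
  "finite Y \<Longrightarrow> kept (node_code p Y N) = Y" "finite N \<Longrightarrow> nbrs (node_code p Y N) = N"
  by (simp_all add: node_code_def parent_def kept_def nbrs_def)

lemma less_node_code: "p < node_code p Y N"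
  unfolding node_code_def by (simp add: le_prod_encode_1 less_Suc_eq_le)

lemma finite_bag [simp]: "finite (bag w)"
  by (simp add: bag_def kept_def)

lemma self_in_bag [simp]: "w \<in> bag w"
  by (simp add: bag_def)

lemma node_codeI:
  "p \<in> nodes k n \<Longrightarrow> N \<subseteq> Y \<Longrightarrow> Y \<subseteq> bag p \<Longrightarrow> card Y \<le> k \<Longrightarrow> node_code p Y N \<in> nodes k (Suc n)"
  by auto

lemma nodes_Suc: "nodes k n \<subseteq> nodes k (Suc n)"
proof (induction n)
  case (Suc n)
  show ?case
  proof
    fix w assume "w \<in> nodes k (Suc n)"
    then consider "w = 0" | p Y N where "w = node_code p Y N" "p \<in> nodes k n" "N \<subseteq> Y"
      "Y \<subseteq> bag p" "card Y \<le> k"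
      by auto
    then show "w \<in> nodes k (Suc (Suc n))"
    proof cases
      case 2
      then have "p \<in> nodes k (Suc n)" using Suc.IH by blast
      with 2 show ?thesis by (simp only: node_codeI)
    qed simp
  qed
qed simp

lemma nodes_mono: "m \<le> n \<Longrightarrow> nodes k m \<subseteq> nodes k n"
  by (rule lift_Suc_mono_le[of "nodes k"]) (rule nodes_Suc)

lemma zero_in_nodes [simp]: "0 \<in> nodes k n"
  by (cases n) auto

lemma finite_nodes: "finite (nodes k n)"
proof (induction n)
  case (Suc n)
  have "nodes k (Suc n) \<subseteq>
      insert 0 (\<Union>p\<in>nodes k n. \<Union>Y\<in>Pow (bag p). \<Union>N\<in>Pow Y. {node_code p Y N})"
    by auto
  moreover have "finite (insert 0 (\<Union>p\<in>nodes k n. \<Union>Y\<in>Pow (bag p). \<Union>N\<in>Pow Y. {node_code p Y N}))"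
    using Suc by (auto intro!: finite_UN_I intro: finite_subset[OF _ finite_bag])
  ultimately show ?case by (rule finite_subset)
qed simp

lemma node_facts:
  assumes "w \<in> nodes k n" "w \<noteq> 0"
  shows "parent w \<in> nodes k n" "parent w < w" "nbrs w \<subseteq> kept w"
    "kept w \<subseteq> bag (parent w)" "card (kept w) \<le> k"
proof -
  obtain m where m: "n = Suc m" using assms by (cases n) auto
  then obtain p Y N where w: "w = node_code p Y N" "p \<in> nodes k m" "N \<subseteq> Y" "Y \<subseteq> bag p" "card Y \<le> k"
    using assms by auto
  then have "finite Y" "finite N" by (meson finite_bag finite_subset)+
  then show "parent w \<in> nodes k n" "parent w < w" "nbrs w \<subseteq> kept w"
    "kept w \<subseteq> bag (parent w)" "card (kept w) \<le> k"
    using w nodes_Suc[of k m] m less_node_code by auto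
qed

lemma bag_subset:
  assumes "w \<in> nodes k n"
  shows "bag w \<subseteq> nodes k n \<inter> {..w}"
  using assms
proof (induction w rule: less_induct)
  case (less w)
  show ?case
  proof (cases "w = 0")
    case False
    then show ?thesis
      using less node_facts[OF less.prems False] by (force simp: bag_def[of w])
  qed (simp add: bag_def)
qed

text \<open>Each edge is recorded at its end with the larger code, which rules out loops.\<close>

lemma nbrs_less:
  assumes "w \<in> nodes k n" "w \<noteq> 0" "u \<in> nbrs w"
  shows "u < w"
  using node_facts[OF assms(1,2)] bag_subset[of "parent w" k n] assms(3) by force

lemma graph_adjacent: "graph (nodes k n) (adjacent (nodes k n))"
  unfolding graph_def adjacent_def using finite_nodes nbrs_less by blast

lemma treewidth_adjacent: "treewidth (nodes k n) (adjacent (nodes k n)) \<le> k"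
proof -
  have "\<exists>TE. tree_decomp (nodes k n) (adjacent (nodes k n)) (nodes k n) TE bag"
  proof (rule parent_tree_decomp[where par = parent])
    show "bag t \<subseteq> insert t (bag (parent t))" if "t \<in> nodes k n" "t \<noteq> 0" for t
      using node_facts[OF that] that by (auto simp: bag_def[of t])
    show "u \<in> nodes k n \<and> w \<in> nodes k n \<and> (u \<in> bag w \<or> w \<in> bag u)"
      if "adjacent (nodes k n) u w" for u w
      using that node_facts(3) unfolding adjacent_def bag_def by auto
    show "t \<in> bag t \<and> bag t \<subseteq> nodes k n" if "t \<in> nodes k n" for t
      using bag_subset[OF that] by auto
  qed (auto simp: finite_nodes bag_def node_facts)
  moreover have "card (bag t) \<le> k + 1" if "t \<in> nodes k n" for t
    using node_facts(5)[OF that] by (auto simp: bag_def card_insert_if kept_def)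
  ultimately show ?thesis unfolding treewidth_def by (intro Least_le) blast
qed

text \<open>The code of the child exceeds every member of \<open>bag t\<close>. Hence the child is
  new to the bag, and no \<open>u\<close> in \<open>Y\<close> can list it as a neighbour, so only
  the prescribed \<open>N\<close> decides adjacency within \<open>Y\<close>.\<close>

lemma nodes_universal:
  assumes "t \<in> nodes k n" "n < m" "N \<subseteq> Y" "Y \<subseteq> bag t" "card Y \<le> k"
  shows "\<exists>w\<in>nodes k (Suc n). w \<in> nodes k m - bag t \<and> bag w = insert w Y \<and>
    (\<forall>u\<in>Y. adjacent (nodes k m) w u \<longleftrightarrow> u \<in> N)"
proof -
  let ?w = "node_code t Y N"
  have fin: "finite Y" "finite N" using assms(3,4) by (meson finite_bag finite_subset)+
  have w: "?w \<in> nodes k (Suc n)" using assms by auto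
  have sub: "nodes k (Suc n) \<subseteq> nodes k m" "nodes k n \<subseteq> nodes k m"
    using assms(2) by (intro nodes_mono; simp)+
  have t: "bag t \<subseteq> nodes k m \<inter> {..t}" using bag_subset assms(1) sub by blast
  have "adjacent (nodes k m) ?w u \<longleftrightarrow> u \<in> N" if "u \<in> Y" for u
  proof -
    have u: "u \<in> nodes k m" "u < ?w"
      using that assms(4) t less_node_code[of t Y N] by force+
    then have "u \<noteq> 0 \<Longrightarrow> ?w \<notin> nbrs u" using nbrs_less by fastforce
    then show ?thesis using u w sub fin unfolding adjacent_def by auto
  qed
  moreover have "?w \<notin> bag t" using t less_node_code[of t Y N] by force
  moreover have "bag ?w = insert ?w Y" using fin by (simp add: bag_def)
  ultimately show ?thesis using w sub by blast
qed

lemma box_rep_adjacent: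
  assumes "box_rep (nodes k (2 * k)) (adjacent (nodes k (2 * k))) b"
  shows "k \<le> b + 1"
proof -
  let ?V = "nodes k (2 * k)" and ?E = "adjacent (nodes k (2 * k))"
  obtain l r :: "nat \<Rightarrow> nat \<Rightarrow> real" where "box_representation ?V ?E b l r"
    using assms graph_adjacent unfolding box_rep_def box_representation_def by blast
  then interpret box_representation ?V ?E b l r .
  show ?thesis
  proof (rule dimension_lower_bound[where T = "\<lambda>n X. \<exists>t\<in>nodes k n. X = bag t" and ?v0.0 = 0])
    show "\<exists>w\<in>?V - X. (\<exists>t\<in>nodes k (Suc n). insert w Y = bag t) \<and> (\<forall>u\<in>Y. ?E w u \<longleftrightarrow> u \<in> N)"
      if "\<exists>t\<in>nodes k n. X = bag t" "n < 2 * k" "N \<subseteq> Y" "Y \<subseteq> X" "card Y \<le> k" for n X Y N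
      using that nodes_universal[of _ k n "2 * k" N Y] by metis
  qed (auto simp: bag_def)
qed

text \<open>Ensures that the \<open>LEAST\<close> in \<open>boxicity\<close> is attained. In
  dimension \<open>i\<close>, vertex \<open>i\<close> gets {0}, its neighbours [0, 1] and all others
  {1}, so exactly the pairs of \<open>i\<close> with a nonneighbour are separated.\<close>

lemma box_rep_exists:
  assumes "graph V E"
  shows "\<exists>b. box_rep V E b"
proof -
  obtain b where b: "V \<subseteq> {..<b}"
    using assms unfolding graph_def finite_nat_set_iff_bounded by blast
  define l where "l v i = (if v = i \<or> E i v then 0 else 1 :: real)" for v i
  define r where "r v i = (if v = i then 0 else 1 :: real)" for v i :: nat
  have "E u v \<longleftrightarrow> (\<forall>i<b. l u i \<le> r v i \<and> l v i \<le> r u i)" if "u \<in> V" "v \<in> V" "u \<noteq> v" for u v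
  proof
    assume "E u v"
    then have "E v u" using assms unfolding graph_def by blast
    then show "\<forall>i<b. l u i \<le> r v i \<and> l v i \<le> r u i"
      using \<open>E u v\<close> unfolding l_def r_def by auto
  next
    assume "\<forall>i<b. l u i \<le> r v i \<and> l v i \<le> r u i"
    then have "l v u \<le> r u u" using that b by auto
    then show "E u v" using that unfolding l_def r_def by (auto split: if_splits)
  qed
  moreover have "l v i \<le> r v i" for v i unfolding l_def r_def by auto
  ultimately show ?thesis unfolding box_rep_def by blast
qed

theorem theorem3:
  fixes k :: nat
  assumes "k \<ge> 1"
  shows "\<exists>V E. graph V E \<and> treewidth V E \<le> k \<and>
           real (boxicity V E) \<ge> real k * (1 - 2 / sqrt (real k))"
proof -
  let ?V = "nodes k (2 * k)" and ?E = "adjacent (nodes k (2 * k))"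
  have "box_rep ?V ?E (boxicity ?V ?E)"
    unfolding boxicity_def using box_rep_exists[OF graph_adjacent] by (rule LeastI_ex)
  then have "k \<le> boxicity ?V ?E + 1" by (rule box_rep_adjacent)
  then have "real k - 1 \<le> real (boxicity ?V ?E)" by linarith
  moreover have "real k * (1 - 2 / sqrt (real k)) = real k - 2 * sqrt (real k)"
    using assms by (simp add: field_simps flip: real_sqrt_mult)
  moreover have "1 \<le> sqrt (real k)" using assms by simp
  ultimately have "real (boxicity ?V ?E) \<ge> real k * (1 - 2 / sqrt (real k))" by linarith
  then show ?thesis using graph_adjacent treewidth_adjacent by blast
qed

end
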